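(* Let $\alpha>0$ and let $p_\alpha(t)=t^\alpha$ for $t\ge0$. Then the following hold. 1. For every $\alpha>0$, $p_\alpha$ preserves positive semidefiniteness and total nonnegativity entrywise on all Min and Max cones; that is, for every $n\ge1$ and every $A\in\mathcal C_{\min,n}\cup\mathcal C_{\max,n}$, the matrix $p_\alpha[A]$ is positive semidefinite and totally nonnegative. 2. For every $\alpha>0$, $p_\alpha$ preserves the strict Min and Max classes (equivalently, the subclasses of nonsingular inverse $M$-matrices within the Min and Max matrices); that is, for every $n\ge1$, $A\in\mathcal C_{\min,n}^{\circ}$ implies $p_\alpha[A]\in\mathcal C_{\min,n}^{\circ}$, and $A\in\mathcal C_{\max,n}^{\circ}$ implies $p_\alpha[A]\in\mathcal C_{\max,n}^{\circ}$. 3. $p_\alpha$ preserves Loewner order entrywise on all Min and Max cones (i.e. $A\preceq B$ implies $p_\alpha[A]\preceq p_\alpha[B]$ for all $A,B$ in the same cone $\mathcal C_{\min,n}$ or $\mathcal C_{\max,n}$, $n\ge1$) if and only if $\alpha\ge1$. 4. The entrywise map induced by $p_\alpha$ is Loewner convex on arbitrary pairs in all Min and Max cones, equivalently Loewner concave on arbitrary pairs in all Min and Max cones, if and only if $\alpha=1$. 5. The entrywise map induced by $p_\alpha$ is Loewner convex on comparable pairs in all Min and Max cones if and only if $\alpha=1$ or $\alpha\ge2$. 6. The entrywise map induced by $p_\alpha$ is Loewner concave on comparable pairs in all Min and Max cones if and only if $\alpha=1$.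
   Context: For $x=(x_1,\ldots,x_n)\in\mathbb R^n$, define the $n\times n$ real symmetric matrices $A_{\min}(x)=\bigl(x_{\min(i,j)}\bigr)_{i,j=1}^n$ (Min matrices) and $A_{\max}(x)=\bigl(x_{\max(i,j)}\bigr)_{i,j=1}^n$ (Max matrices). The Min and Max cones are $\mathcal C_{\min,n}=\{A_{\min}(x):0\le x_1\le\cdots\le x_n\}$ and $\mathcal C_{\max,n}=\{A_{\max}(x):x_1\ge\cdots\ge x_n\ge0\}$; the strict classes are $\mathcal C_{\min,n}^{\circ}=\{A_{\min}(x):0<x_1<\cdots<x_n\}$ and $\mathcal C_{\max,n}^{\circ}=\{A_{\max}(x):x_1>\cdots>x_n>0\}$. "All Min and Max cones" means $\mathcal C_{\min,n}$ and $\mathcal C_{\max,n}$ for all $n\ge1$. For a matrix $A=(a_{ij})$ with entries in $[0,\infty)$ and $f:[0,\infty)\to\mathbb R$, $f[A]=(f(a_{ij}))$; the entrywise map induced by $f$ is $A\mapsto f[A]$. For real symmetric matrices, $A\preceq B$ means that $B-A$ is positive semidefinite. A matrix is totally nonnegative if all its minors are nonnegative. A $Z$-matrix is a real square matrix with nonpositive off-diagonal entries; a nonsingular $M$-matrix is a nonsingular $Z$-matrix whose inverse is entrywise nonnegative; a nonsingular inverse $M$-matrix is a nonsingular matrix whose inverse is a nonsingular $M$-matrix. The entrywise map induced by $f$ is Loewner convex on arbitrary pairs in a cone $\mathcal C$ if $f[\lambda A+(1-\lambda)B]\preceq\lambda f[A]+(1-\lambda)f[B]$ for all $A,B\in\mathcal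 C$, $0\le\lambda\le1$; it is Loewner convex on comparable pairs in $\mathcal C$ if this inequality holds whenever $A,B\in\mathcal C$, $B\preceq A$ and $0\le\lambda\le1$. Loewner concave (on arbitrary or comparable pairs) is defined by the reverse inequality $\lambda f[A]+(1-\lambda)f[B]\preceq f[\lambda A+(1-\lambda)B]$. *)

theory Defs
  imports Complex_Main "Jordan_Normal_Form.Determinant" "Jordan_Normal_Form.DL_Submatrix"
begin

text \<open>Indices are 0-based: the entry \<open>x $ i\<close> is the coordinate with number \<open>i + 1\<close>.\<close>

definition min_mat :: "real vec \<Rightarrow> real mat" where
  "min_mat x = mat (dim_vec x) (dim_vec x) (\<lambda>(i, j). x $ min i j)"

definition max_mat :: "real vec \<Rightarrow> real mat" where
  "max_mat x = mat (dim_vec x) (dim_vec x) (\<lambda>(i, j). x $ max i j)"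

text \<open>
  The chains that define the classes include the bound 0: the list \<open>0 # list_of_vec x\<close> is
  increasing, respectively \<open>list_of_vec x @ [0]\<close> is decreasing.
\<close>

definition min_cone :: "nat \<Rightarrow> real mat set" where
  "min_cone n = {min_mat x | x. x \<in> carrier_vec n \<and> sorted_wrt (\<le>) (0 # list_of_vec x)}"

definition max_cone :: "nat \<Rightarrow> real mat set" where
  "max_cone n = {max_mat x | x. x \<in> carrier_vec n \<and> sorted_wrt (\<ge>) (list_of_vec x @ [0])}"

definition strict_min_class :: "nat \<Rightarrow> real mat set" where
  "strict_min_class n = {min_mat x | x. x \<in> carrier_vec n \<and> sorted_wrt (<) (0 # list_of_vec x)}"

definition strict_max_class :: "nat \<Rightarrow> real mat set" where
  "strict_max_class n = {max_mat x | x. x \<in> carrier_vec n \<and> sorted_wrt (>) (list_of_vec x @ [0])}"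

definition psd_mat :: "real mat \<Rightarrow> bool" where
  "psd_mat A \<longleftrightarrow> square_mat A \<and> transpose_mat A = A \<and>
     (\<forall>v \<in> carrier_vec (dim_row A). 0 \<le> v \<bullet> (A *\<^sub>v v))"

text \<open>The dimensions are compared explicitly because subtraction of matrices is total.\<close>

definition loewner_le :: "real mat \<Rightarrow> real mat \<Rightarrow> bool" (infix \<open>\<preceq>\<^sub>L\<close> 50) where
  "A \<preceq>\<^sub>L B \<longleftrightarrow> dim_row A = dim_row B \<and> dim_col A = dim_col B \<and>
     transpose_mat A = A \<and> transpose_mat B = B \<and> psd_mat (B - A)"

definition totally_nonneg :: "real mat \<Rightarrow> bool" where
  "totally_nonneg A \<longleftrightarrow> (\<forall>I J. I \<subseteq> {..<dim_row A} \<and> J \<subseteq> {..<dim_col A} \<and> card I = card J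
     \<longrightarrow> 0 \<le> det (submatrix A I J))"

definition Z_mat :: "real mat \<Rightarrow> bool" where
  "Z_mat A \<longleftrightarrow> square_mat A \<and> (\<forall>i < dim_row A. \<forall>j < dim_col A. i \<noteq> j \<longrightarrow> A $$ (i, j) \<le> 0)"

definition entrywise_nonneg :: "real mat \<Rightarrow> bool" where
  "entrywise_nonneg A \<longleftrightarrow> (\<forall>i < dim_row A. \<forall>j < dim_col A. 0 \<le> A $$ (i, j))"

text \<open>For a square matrix \<open>A\<close> a matrix \<open>B\<close> with this property is unique.\<close>

definition is_inverse_mat :: "real mat \<Rightarrow> real mat \<Rightarrow> bool" where
  "is_inverse_mat A B \<longleftrightarrow> inverts_mat A B \<and> inverts_mat B A"

definition nonsingular_M_mat :: "real mat \<Rightarrow> bool" where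
  "nonsingular_M_mat A \<longleftrightarrow> Z_mat A \<and> (\<exists>B. is_inverse_mat A B \<and> entrywise_nonneg B)"

definition nonsingular_inverse_M_mat :: "real mat \<Rightarrow> bool" where
  "nonsingular_inverse_M_mat A \<longleftrightarrow>
     square_mat A \<and> (\<exists>B. is_inverse_mat A B \<and> nonsingular_M_mat B)"

definition inverse_M_min_class :: "nat \<Rightarrow> real mat set" where
  "inverse_M_min_class n = {min_mat x | x. x \<in> carrier_vec n \<and> nonsingular_inverse_M_mat (min_mat x)}"

definition inverse_M_max_class :: "nat \<Rightarrow> real mat set" where
  "inverse_M_max_class n = {max_mat x | x. x \<in> carrier_vec n \<and> nonsingular_inverse_M_mat (max_mat x)}"

text \<open>
  The functions of interest live on the nonnegative reals. They are rendered as functions on all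
  reals; the predicates below are only used for sets of matrices with nonnegative entries that
  are closed under the convex combinations involved, so values at negative arguments do not matter.
\<close>

definition preserves_class :: "(real \<Rightarrow> real) \<Rightarrow> real mat set \<Rightarrow> bool" where
  "preserves_class f C \<longleftrightarrow> (\<forall>A \<in> C. map_mat f A \<in> C)"

definition preserves_loewner_order :: "(real \<Rightarrow> real) \<Rightarrow> real mat set \<Rightarrow> bool" where
  "preserves_loewner_order f C \<longleftrightarrow>
     (\<forall>A \<in> C. \<forall>B \<in> C. A \<preceq>\<^sub>L B \<longrightarrow> map_mat f A \<preceq>\<^sub>L map_mat f B)"

definition loewner_convex_ineq :: "(real \<Rightarrow> real) \<Rightarrow> real mat \<Rightarrow> real mat \<Rightarrow> real \<Rightarrow> bool" where
  "loewner_convex_ineq f A B l \<longleftrightarrow>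
     map_mat f (l \<cdot>\<^sub>m A + (1 - l) \<cdot>\<^sub>m B) \<preceq>\<^sub>L l \<cdot>\<^sub>m map_mat f A + (1 - l) \<cdot>\<^sub>m map_mat f B"

definition loewner_concave_ineq :: "(real \<Rightarrow> real) \<Rightarrow> real mat \<Rightarrow> real mat \<Rightarrow> real \<Rightarrow> bool" where
  "loewner_concave_ineq f A B l \<longleftrightarrow>
     l \<cdot>\<^sub>m map_mat f A + (1 - l) \<cdot>\<^sub>m map_mat f B \<preceq>\<^sub>L map_mat f (l \<cdot>\<^sub>m A + (1 - l) \<cdot>\<^sub>m B)"

definition loewner_convex_arbitrary :: "(real \<Rightarrow> real) \<Rightarrow> real mat set \<Rightarrow> bool" where
  "loewner_convex_arbitrary f C \<longleftrightarrow>
     (\<forall>A \<in> C. \<forall>B \<in> C. \<forall>l \<in> {0..1}. loewner_convex_ineq f A B l)"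

definition loewner_concave_arbitrary :: "(real \<Rightarrow> real) \<Rightarrow> real mat set \<Rightarrow> bool" where
  "loewner_concave_arbitrary f C \<longleftrightarrow>
     (\<forall>A \<in> C. \<forall>B \<in> C. \<forall>l \<in> {0..1}. loewner_concave_ineq f A B l)"

definition loewner_convex_comparable :: "(real \<Rightarrow> real) \<Rightarrow> real mat set \<Rightarrow> bool" where
  "loewner_convex_comparable f C \<longleftrightarrow>
     (\<forall>A \<in> C. \<forall>B \<in> C. B \<preceq>\<^sub>L A \<longrightarrow> (\<forall>l \<in> {0..1}. loewner_convex_ineq f A B l))"

definition loewner_concave_comparable :: "(real \<Rightarrow> real) \<Rightarrow> real mat set \<Rightarrow> bool" where
  "loewner_concave_comparable f C \<longleftrightarrow>
     (\<forall>A \<in> C. \<forall>B \<in> C. B \<preceq>\<^sub>L A \<longrightarrow> (\<forall>l \<in> {0..1}. loewner_concave_ineq f A B l))"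

definition min_max_cones :: "real mat set set" where
  "min_max_cones = (\<Union>n \<in> {1..}. {min_cone n, max_cone n})"

definition pow_fun :: "real \<Rightarrow> real \<Rightarrow> real" where
  "pow_fun \<alpha> t = t powr \<alpha>"

end

theory Submission
  imports Defs "HOL-Analysis.Convex" "HOL-Real_Asymp.Real_Asymp"
begin

text \<open>
  A Min matrix and a Max matrix are the same object up to the order of the indices: both have the
  form \<open>(g (min (s i) (s j)))\<close>, where \<open>g 1, \<dots>, g n\<close> are the entries in the order in
  which they are supposed to grow, \<open>g 0 = 0\<close>, and \<open>s\<close> numbers the indices upwards (Min) or
  downwards (Max). Writing \<open>g\<close> as the sum of its increments
  \<open>d\<^sub>k = g (k + 1) - g k\<close> diagonalizes the quadratic form,
    \<open>v \<bullet> A v = (\<Sum>k<n. d\<^sub>k * (\<Sum>i | s i > k. v\<^sub>i)\<^sup>2)\<close>,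
  and the linear forms that are squared here form a system of coordinates. So such a matrix is
  positive semidefinite iff \<open>g\<close> is nondecreasing, starting at 0
  (\<open>psd_rank_mat_iff\<close>), and \<open>A \<preceq> B\<close> compares increments
  (\<open>loewner_le_rank_mat_iff\<close>). The same diagonalization inverts the matrix, and the signs of
  the inverse show that the inverse M-matrices are those with positive increments
  (\<open>inverse_M_rank_mat_iff\<close>). Total nonnegativity holds since for monotone \<open>g\<close> a minor has
  entries \<open>min a\<^sub>i b\<^sub>j\<close> with two monotone sequences, and one elimination step leads to a
  smaller determinant of this shape (\<open>det_min_mono_nonneg\<close>).

  Entrywise functions and linear combinations act on the sequence \<open>g\<close>, so every claim about
  Loewner order becomes one about a real function on consecutive levels. Order preservation says
  that an increment of \<open>t\<^sup>\<alpha>\<close> grows with its starting point and its length, which is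
  convexity. Convexity and concavity concern the Jensen gap
  \<open>l f x + (1 - l) f y - f (l x + (1 - l) y)\<close>: it has to grow, respectively fall, when
  \<open>(x, y)\<close> moves to the next pair of levels. For comparable matrices the pair satisfies
  \<open>y \<le> x\<close> and the step in \<open>x\<close> is at least the step in \<open>y\<close>. If \<open>\<alpha> \<ge> 2\<close>, the derivative of
  \<open>t\<^sup>\<alpha>\<close> is increasing and convex, and Chebyshev's inequality makes the gap grow
  (\<open>jensen_gap_powr_mono\<close>).

  All necessary conditions are visible for two rows. The steps from \<open>(0, 0)\<close> to
  \<open>(1, 0)\<close> compare \<open>\<alpha>\<close> with 1; steps from \<open>(2, 0)\<close> to \<open>(2 + s, s)\<close> with small \<open>s\<close>
  see whether the derivative is convex between 0 and 2, which excludes \<open>1 < \<alpha> < 2\<close> for convexity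
  and \<open>\<alpha> < 1\<close> for concavity; and for arbitrary pairs the step from \<open>(1, 0)\<close> to \<open>(1, 1)\<close>
  forces the gap at \<open>(1, 0)\<close> to vanish.
\<close>

section \<open>The Jensen gap of power functions\<close>

definition jensen_gap :: "(real \<Rightarrow> real) \<Rightarrow> real \<Rightarrow> real \<Rightarrow> real \<Rightarrow> real" where
  "jensen_gap f l x y = l * f x + (1 - l) * f y - f (l * x + (1 - l) * y)"

lemma continuous_on_powr_const:
  fixes f :: "real \<Rightarrow> real"
  assumes "continuous_on S f" "\<And>x. x \<in> S \<Longrightarrow> 0 \<le> f x" "0 < \<alpha>"
  shows "continuous_on S (\<lambda>x. f x powr \<alpha>)"
  using assms by (intro continuous_on_powr') auto

text \<open>
  The increment over an interval of fixed length grows with the starting point, since the derivative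
  of a convex power is increasing; lengthening the interval on the right only adds to it.
\<close>

lemma powr_increment_mono:
  fixes \<alpha> a b c d :: real
  assumes "1 \<le> \<alpha>" "0 \<le> a" "a \<le> b" "a \<le> c" "b - a \<le> d - c"
  shows "b powr \<alpha> - a powr \<alpha> \<le> d powr \<alpha> - c powr \<alpha>"
proof -
  define h where "h = c - a"
  have h: "0 \<le> h" using assms by (simp add: h_def)
  have "(a + h) powr \<alpha> - a powr \<alpha> \<le> (b + h) powr \<alpha> - b powr \<alpha>"
  proof (rule DERIV_nonneg_imp_increasing_open[OF \<open>a \<le> b\<close>])
    fix x assume x: "a < x" "x < b"
    have "((\<lambda>x. (x + h) powr \<alpha> - x powr \<alpha>) has_real_derivative
        \<alpha> * (x + h) powr (\<alpha> - 1) - \<alpha> * x powr (\<alpha> - 1)) (at x)"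
      using x h assms by (auto intro!: derivative_eq_intros simp: mult_ac powr_diff)
    moreover have "0 \<le> \<alpha> * (x + h) powr (\<alpha> - 1) - \<alpha> * x powr (\<alpha> - 1)"
      using x h assms by (simp add: mult_left_mono powr_mono2)
    ultimately show "\<exists>y. ((\<lambda>x. (x + h) powr \<alpha> - x powr \<alpha>) has_real_derivative y) (at x) \<and> 0 \<le> y"
      by blast
  next
    show "continuous_on {a..b} (\<lambda>x. (x + h) powr \<alpha> - x powr \<alpha>)"
      using assms h by (intro continuous_on_diff continuous_on_powr_const continuous_intros) auto
  qed
  moreover have "(b + h) powr \<alpha> \<le> d powr \<alpha>"
    using assms h by (intro powr_mono2) (auto simp: h_def)
  ultimately show ?thesis by (simp add: h_def)
qed

text \<open>
  This is the sign of the derivative of the Jensen gap: \<open>p\<close>, \<open>q\<close> are the speeds of the two points,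
  \<open>u\<close>, \<open>v\<close> the slopes of the function there and \<open>w\<close> its slope at the convex combination. Convexity
  of the slope bounds \<open>w\<close>; what is left over is the Chebyshev term
  \<open>l (1 - l) (p - q) (u - v)\<close>, nonnegative since speeds and slopes are ordered in the same way.
\<close>

lemma convex_slope_chebyshev:
  fixes l p q u v w :: real
  assumes "0 \<le> l" "l \<le> 1" "0 \<le> q" "q \<le> p" "v \<le> u" "w \<le> l * u + (1 - l) * v"
  shows "(l * p + (1 - l) * q) * w \<le> l * (p * u) + (1 - l) * (q * v)"
proof -
  have "0 \<le> l * p + (1 - l) * q" using assms by simp
  then have "(l * p + (1 - l) * q) * w \<le> (l * p + (1 - l) * q) * (l * u + (1 - l) * v)"
    using assms by (intro mult_left_mono)
  also have "\<dots> = l * (p * u) + (1 - l) * (q * v) - l * (1 - l) * (p - q) * (u - v)"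
    by (simp add: algebra_simps)
  also have "\<dots> \<le> l * (p * u) + (1 - l) * (q * v)"
    using assms by simp
  finally show ?thesis .
qed

text \<open>
  Both points move linearly, and the derivative of the gap is nonnegative by
  \<open>convex_slope_chebyshev\<close>, because \<open>t powr (\<alpha> - 1)\<close> is convex and increasing.
\<close>

lemma jensen_gap_powr_mono:
  fixes \<alpha> l a b c d :: real
  assumes \<alpha>: "2 \<le> \<alpha>" and l: "0 \<le> l" "l \<le> 1"
    and le: "0 \<le> c" "c \<le> a" "c \<le> d" "d - c \<le> b - a"
  shows "jensen_gap (pow_fun \<alpha>) l a c \<le> jensen_gap (pow_fun \<alpha>) l b d"
proof (cases "d = 0")
  \<comment> \<open>The derivative of a real power is taken at positive arguments, so the case of a second point that
    rests at 0 is separate; there the gap is a nonnegative multiple of \<open>x powr \<alpha>\<close>.\<close>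
  case True
  then have "c = 0" using le by simp
  have "l powr \<alpha> \<le> l"
    using l \<alpha> powr_mono'[of 1 \<alpha> l] by simp
  then have "(l - l powr \<alpha>) * a powr \<alpha> \<le> (l - l powr \<alpha>) * b powr \<alpha>"
    using le \<alpha> by (intro mult_left_mono powr_mono2) auto
  then show ?thesis
    using True \<open>c = 0\<close> l le \<alpha>
    by (simp add: jensen_gap_def pow_fun_def powr_mult algebra_simps)
next
  case False
  define p where "p = b - a"
  define q where "q = d - c"
  define x where "x s = a + s * p" for s
  define y where "y s = c + s * q" for s
  define m where "m s = l * x s + (1 - l) * y s" for s
  have pq: "0 \<le> q" "q \<le> p" using le by (auto simp: p_def q_def)
  have y_nonneg: "0 \<le> y s" and xy: "y s \<le> x s" if "0 \<le> s" for s
    using that le pq by (auto simp: x_def y_def intro!: add_mono mult_left_mono)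
  have m_nonneg: "0 \<le> m s" if "0 \<le> s" for s
    unfolding m_def using y_nonneg[OF that] xy[OF that] l by simp
  define F where "F s = l * x s powr \<alpha> + (1 - l) * y s powr \<alpha> - m s powr \<alpha>" for s
  have "F 0 \<le> F 1"
  proof (rule DERIV_nonneg_imp_increasing_open[where f = F])
    fix s :: real assume s: "0 < s" "s < 1"
    have y: "0 < y s"
    proof (cases "c = 0")
      case True
      then have "0 < q" using False le by (simp add: q_def)
      then show ?thesis using True s by (simp add: y_def)
    qed (use le s pq in \<open>auto simp: y_def intro!: add_pos_nonneg\<close>)
    have x: "0 < x s" using y xy[of s] s by simp
    have m: "0 < m s"
      unfolding m_def using x y l by (cases "l = 0") (auto intro!: add_pos_nonneg)
    have "(F has_real_derivative
        l * (\<alpha> * x s powr (\<alpha> - 1) * p) + (1 - l) * (\<alpha> * y s powr (\<alpha> - 1) * q)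
          - \<alpha> * m s powr (\<alpha> - 1) * (l * p + (1 - l) * q)) (at s)"
    proof -
      have dx: "(x has_real_derivative p) (at s)" and dy: "(y has_real_derivative q) (at s)"
        unfolding x_def y_def by (auto intro!: derivative_eq_intros)
      have dm: "(m has_real_derivative l * p + (1 - l) * q) (at s)"
        unfolding m_def by (intro DERIV_add DERIV_cmult dx dy)
      show ?thesis
        unfolding F_def
        by (intro DERIV_add DERIV_diff DERIV_cmult
            DERIV_cong[OF DERIV_fun_powr[OF dx x]] DERIV_cong[OF DERIV_fun_powr[OF dy y]]
            DERIV_cong[OF DERIV_fun_powr[OF dm m]]) simp_all
    qed
    moreover have "0 \<le> l * (\<alpha> * x s powr (\<alpha> - 1) * p) + (1 - l) * (\<alpha> * y s powr (\<alpha> - 1) * q)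
          - \<alpha> * m s powr (\<alpha> - 1) * (l * p + (1 - l) * q)"
    proof -
      have "m s powr (\<alpha> - 1) \<le> l * x s powr (\<alpha> - 1) + (1 - l) * y s powr (\<alpha> - 1)"
        using convex_onD[OF powr_convex, of "\<alpha> - 1" "1 - l" "x s" "y s"] \<alpha> l x y
        by (simp add: m_def)
      moreover have "y s powr (\<alpha> - 1) \<le> x s powr (\<alpha> - 1)"
        using y xy[of s] s \<alpha> by (intro powr_mono2) auto
      ultimately have "(l * p + (1 - l) * q) * m s powr (\<alpha> - 1)
          \<le> l * (p * x s powr (\<alpha> - 1)) + (1 - l) * (q * y s powr (\<alpha> - 1))"
        using l pq by (intro convex_slope_chebyshev)
      then have "\<alpha> * ((l * p + (1 - l) * q) * m s powr (\<alpha> - 1))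
          \<le> \<alpha> * (l * (p * x s powr (\<alpha> - 1)) + (1 - l) * (q * y s powr (\<alpha> - 1)))"
        using \<alpha> by (intro mult_left_mono) auto
      then show ?thesis by (simp add: algebra_simps)
    qed
    ultimately show "\<exists>D. (F has_real_derivative D) (at s) \<and> 0 \<le> D" by blast
  next
    have "continuous_on {0..1} x" "continuous_on {0..1} y" "continuous_on {0..1} m"
      unfolding m_def x_def y_def by (intro continuous_intros)+
    moreover have "0 \<le> x s" "0 \<le> y s" "0 \<le> m s" if "s \<in> {0..1}" for s :: real
      using that y_nonneg[of s] xy[of s] m_nonneg[of s] by auto
    ultimately show "continuous_on {0..1} F"
      unfolding F_def using \<alpha>
      by (intro continuous_on_diff continuous_on_add continuous_on_mult_left
          continuous_on_powr_const) auto
  qed simp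
  then show ?thesis
    by (simp add: F_def m_def x_def y_def p_def q_def jensen_gap_def pow_fun_def)
qed

text \<open>
  Along this path both points have the same speed, so the Chebyshev term vanishes and the change of
  the gap depends only on how the slopes at 0, 1 and 2 compare.
\<close>

lemma jensen_gap_along_diagonal:
  fixes \<alpha> s :: real
  assumes "0 < \<alpha>" "0 < s"
  shows "jensen_gap (pow_fun \<alpha>) (1/2) (2 + s) s - jensen_gap (pow_fun \<alpha>) (1/2) 2 0 =
    ((2 + s) powr \<alpha> - 2 powr \<alpha>) / 2 + s powr \<alpha> / 2 - ((1 + s) powr \<alpha> - 1)"
proof -
  have "(2 + s) / 2 + s / 2 = 1 + s" by (simp add: field_simps)
  then show ?thesis using assms by (simp add: jensen_gap_def pow_fun_def diff_divide_distrib)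
qed

text \<open>
  The right derivative at \<open>s = 0\<close> is \<open>\<alpha> (2 powr (\<alpha> - 2) - 1)\<close>, the excess of the mean slope of
  \<open>t powr \<alpha>\<close> at 0 and 2 over the slope at 1. It is nonnegative only for \<open>\<alpha> \<ge> 2\<close>.
\<close>

lemma powr_exponent_ge_2_if_gap_increasing:
  fixes \<alpha> :: real
  assumes \<alpha>: "1 < \<alpha>"
    and gap: "\<And>s. 0 < s \<Longrightarrow> jensen_gap (pow_fun \<alpha>) (1/2) 2 0 \<le> jensen_gap (pow_fun \<alpha>) (1/2) (2 + s) s"
  shows "2 \<le> \<alpha>"
proof -
  let ?K = "\<lambda>s::real. (((2 + s) powr \<alpha> - 2 powr \<alpha>) / 2 + s powr \<alpha> / 2 - ((1 + s) powr \<alpha> - 1)) / s"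
  have "(?K \<longlongrightarrow> \<alpha> * 2 powr \<alpha> / 4 - \<alpha>) (at_right 0)"
    using \<alpha> by real_asymp
  moreover have "eventually (\<lambda>s. 0 \<le> ?K s) (at_right 0)"
  proof (rule eventually_at_rightI[of 0 1])
    fix s :: real assume s: "s \<in> {0<..<1}"
    then show "0 \<le> ?K s"
      using gap[of s] jensen_gap_along_diagonal[of \<alpha> s] \<alpha>
      by (intro divide_nonneg_pos) auto
  qed simp
  ultimately have "0 \<le> \<alpha> * 2 powr \<alpha> / 4 - \<alpha>"
    by (rule tendsto_lowerbound) simp
  then have "\<alpha> * 4 \<le> \<alpha> * 2 powr \<alpha>" by simp
  then have "2 powr 2 \<le> (2::real) powr \<alpha>" using \<alpha> by simp
  then show ?thesis by (subst (asm) powr_le_cancel_iff) auto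
qed

text \<open>
  For \<open>\<alpha> < 1\<close> the slope at 0 is infinite, so the term \<open>s powr \<alpha> / 2\<close> dominates for small \<open>s\<close> and the
  gap increases.
\<close>

lemma powr_exponent_eq_1_if_gap_decreasing:
  fixes \<alpha> :: real
  assumes \<alpha>: "0 < \<alpha>" "\<alpha> \<le> 1"
    and gap: "\<And>s. 0 < s \<Longrightarrow> jensen_gap (pow_fun \<alpha>) (1/2) (2 + s) s \<le> jensen_gap (pow_fun \<alpha>) (1/2) 2 0"
  shows "\<alpha> = 1"
proof (rule ccontr)
  assume "\<alpha> \<noteq> 1"
  \<comment> \<open>This \<open>s\<close> solves \<open>s powr \<alpha> = 3 * s\<close>. A decreasing gap forces \<open>s powr \<alpha> \<le> 2 * s\<close>, because
    \<open>(1 + s) powr \<alpha> - 1 \<le> s\<close>.\<close>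
  define s :: real where "s = 3 powr (1 / (\<alpha> - 1))"
  have s: "0 < s" by (simp add: s_def)
  have "s powr \<alpha> = s powr 1 * s powr (\<alpha> - 1)"
    using powr_add[of s 1 "\<alpha> - 1"] by simp
  also have "s powr (\<alpha> - 1) = 3" using \<open>\<alpha> \<noteq> 1\<close> by (simp add: s_def powr_powr)
  finally have "s powr \<alpha> = 3 * s" using s by simp
  moreover have "(1 + s) powr \<alpha> \<le> (1 + s :: real)"
    using powr_mono[of \<alpha> 1 "1 + s"] \<alpha> s by simp
  moreover have "(2::real) powr \<alpha> \<le> (2 + s) powr \<alpha>" using \<alpha> s by (intro powr_mono2) auto
  moreover have "((2 + s) powr \<alpha> - 2 powr \<alpha>) / 2 + s powr \<alpha> / 2 \<le> (1 + s) powr \<alpha> - 1"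
    using gap[OF s] jensen_gap_along_diagonal[OF \<alpha>(1) s] by linarith
  moreover have False if "P \<le> 1 + s" "T \<le> T'" "(T' - T) / 2 + (3 * s) / 2 \<le> P - 1" for P T T' :: real
    using that s by (simp add: field_simps)
  ultimately show False by metis
qed

lemma powr_half_le_half_iff: "(1/2) powr \<alpha> \<le> 1/2 \<longleftrightarrow> 1 \<le> (\<alpha>::real)"
  using powr_mono'[of 1 \<alpha> "1/2"] powr_less_mono'[of "1/2" \<alpha> 1]
  by (auto simp: not_less[symmetric])

section \<open>Min and Max matrices as one family\<close>

text \<open>
  The common shape of Min and Max matrices: \<open>s\<close> is the position of an index in the order of growth,
  counted from 1, and \<open>g k\<close> is the entry at position \<open>k\<close>. With \<open>s = Suc\<close> this is a Min matrix, with
  \<open>s i = n - i\<close> a Max matrix. The value \<open>g 0\<close> is no entry; setting it to 0 makes the smallest entry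
  an increment like the others.
\<close>

definition rank_mat :: "nat \<Rightarrow> (nat \<Rightarrow> nat) \<Rightarrow> (nat \<Rightarrow> real) \<Rightarrow> real mat" where
  "rank_mat n s g = mat n n (\<lambda>(i, j). g (min (s i) (s j)))"

text \<open>
  Bijectivity makes the matrix a Min matrix with rows and columns permuted simultaneously.
  Monotonicity leaves only the identity and the reversal, which respect the signs of minors.
\<close>

locale ranking =
  fixes n :: nat and s :: "nat \<Rightarrow> nat"
  assumes bij: "bij_betw s {..<n} {1..n}"
    and monotone: "mono_on {..<n} s \<or> antimono_on {..<n} s"

lemma ranking_Suc: "ranking n Suc"
proof
  show "bij_betw Suc {..<n} {1..n}"
    by (rule bij_betwI[where g = "\<lambda>k. k - 1"]) auto
qed (auto intro: monotone_onI)

lemma ranking_reverse: "ranking n (\<lambda>i. n - i)"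
proof
  show "bij_betw (\<lambda>i. n - i) {..<n} {1..n}"
    by (rule bij_betwI[where g = "\<lambda>k. n - k"]) auto
qed (auto intro: monotone_onI)

lemma rank_mat_carrier [simp]: "rank_mat n s g \<in> carrier_mat n n"
  by (simp add: rank_mat_def)

lemma rank_mat_dim [simp]: "dim_row (rank_mat n s g) = n" "dim_col (rank_mat n s g) = n"
  by (simp_all add: rank_mat_def)

lemma rank_mat_index [simp]:
  "i < n \<Longrightarrow> j < n \<Longrightarrow> rank_mat n s g $$ (i, j) = g (min (s i) (s j))"
  by (simp add: rank_mat_def)

lemma transpose_rank_mat [simp]: "transpose_mat (rank_mat n s g) = rank_mat n s g"
  by (auto simp: rank_mat_def min.commute)

lemma map_rank_mat: "map_mat f (rank_mat n s g) = rank_mat n s (\<lambda>k. f (g k))"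
  by auto

lemma diff_rank_mat: "rank_mat n s g - rank_mat n s h = rank_mat n s (\<lambda>k. g k - h k)"
  by auto

lemma combination_rank_mat:
  "a \<cdot>\<^sub>m rank_mat n s g + b \<cdot>\<^sub>m rank_mat n s h = rank_mat n s (\<lambda>k. a * g k + b * h k)"
  by auto

lemma levels_telescope:
  fixes g :: "nat \<Rightarrow> real"
  assumes "g 0 = 0" "m \<le> n"
  shows "g m = (\<Sum>k<n. (g (Suc k) - g k) * of_bool (k < m))"
proof -
  have "(\<Sum>k<n. (g (Suc k) - g k) * of_bool (k < m)) = (\<Sum>k<m. g (Suc k) - g k)"
    using assms by (intro sum.mono_neutral_cong_right) auto
  then show ?thesis using assms by (simp add: sum_lessThan_telescope)
qed

lemma levels_mono:
  fixes g :: "nat \<Rightarrow> real"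
  assumes "\<forall>k<n. g k \<le> g (Suc k)" "j \<le> k" "k \<le> n"
  shows "g j \<le> g k"
  using assms(2,3)
proof (induction k rule: dec_induct)
  case (step m)
  then show ?case using assms(1) by (meson Suc_le_lessD Suc_leD order_trans)
qed simp

context ranking
begin

lemma rank_le: "i < n \<Longrightarrow> s i \<le> n" and rank_pos: "i < n \<Longrightarrow> 0 < s i"
  using bij_betwE[OF bij] by (force dest: bspec[where x = i])+

lemma rank_inj: "i < n \<Longrightarrow> j < n \<Longrightarrow> s i = s j \<longleftrightarrow> i = j"
  using bij by (auto simp: bij_betw_def dest: inj_onD)

lemma rank_surj:
  assumes "0 < k" "k \<le> n"
  obtains i where "i < n" "s i = k"
  using bij assms by (auto simp: bij_betw_def) (metis atLeastAtMost_iff imageE lessThan_iff Suc_leI)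

lemma rank_mat_entry:
  fixes g :: "nat \<Rightarrow> real"
  assumes "g 0 = 0" "i < n" "j < n"
  shows "g (min (s i) (s j)) =
    (\<Sum>k<n. (g (Suc k) - g k) * (of_bool (k < s i) * of_bool (k < s j)))"
proof -
  have "g (min (s i) (s j)) = (\<Sum>k<n. (g (Suc k) - g k) * of_bool (k < min (s i) (s j)))"
    using assms rank_le[of i] by (intro levels_telescope[of g]) auto
  then show ?thesis by (simp add: of_bool_conj)
qed

text \<open>
  The entry at \<open>(i, j)\<close> collects the increments \<open>k\<close> that lie below both positions, so it is a sum over
  \<open>k\<close> of products of one factor for \<open>i\<close> and one for \<open>j\<close>; exchanging the sums produces squares.
\<close>

lemma rank_mat_quadratic_form:
  assumes "g 0 = 0" "v \<in> carrier_vec n"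
  shows "v \<bullet> (rank_mat n s g *\<^sub>v v) =
    (\<Sum>k<n. (g (Suc k) - g k) * (\<Sum>i<n. of_bool (k < s i) * v $ i)\<^sup>2)"
proof -
  have "v \<bullet> (rank_mat n s g *\<^sub>v v) = (\<Sum>i<n. \<Sum>j<n. v $ i * (g (min (s i) (s j)) * v $ j))"
    using assms(2)
    by (simp add: scalar_prod_def sum_distrib_left flip: lessThan_atLeast0)
  also have "\<dots> = (\<Sum>i<n. \<Sum>j<n. \<Sum>k<n. (g (Suc k) - g k) *
      ((of_bool (k < s i) * v $ i) * (of_bool (k < s j) * v $ j)))"
    by (intro sum.cong refl)
      (simp add: rank_mat_entry[where g = g, OF \<open>g 0 = 0\<close>] sum_distrib_left sum_distrib_right mult_ac
        del: sum_of_bool_mult_eq sum_mult_of_bool_eq)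
  also have "\<dots> = (\<Sum>i<n. \<Sum>k<n. \<Sum>j<n. (g (Suc k) - g k) *
      ((of_bool (k < s i) * v $ i) * (of_bool (k < s j) * v $ j)))"
    by (intro sum.cong refl sum.swap)
  also have "\<dots> = (\<Sum>k<n. \<Sum>i<n. \<Sum>j<n. (g (Suc k) - g k) *
      ((of_bool (k < s i) * v $ i) * (of_bool (k < s j) * v $ j)))"
    by (rule sum.swap)
  finally show ?thesis
    unfolding power2_eq_square sum_product by (simp only: sum_distrib_left)
qed

text \<open>
  The matrix of thresholds \<open>k < s i\<close> is triangular up to the order of the indices, and
  \<open>step_coeff\<close> is its inverse: the difference of the unit vectors at positions \<open>k + 1\<close> and \<open>k\<close>,
  without the second one if \<open>k = 0\<close>. The next two lemmas say that it is an inverse on either side.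
\<close>

definition step_coeff :: "nat \<Rightarrow> nat \<Rightarrow> real" where
  "step_coeff k i = of_bool (s i = Suc k) - of_bool (s i = k)"

lemma step_coeff_threshold:
  assumes "k < n"
  shows "(\<Sum>i<n. of_bool (l < s i) * step_coeff k i) = of_bool (l = k)"
proof -
  have "(\<Sum>i<n. of_bool (l < s i) * step_coeff k i) =
      (\<Sum>m\<in>{1..n}. of_bool (l < m) * (of_bool (m = Suc k) - of_bool (m = k)) :: real)"
    unfolding step_coeff_def by (rule sum.reindex_bij_betw[OF bij])
  also have "\<dots> = (\<Sum>m\<in>{1..n}. of_bool (l < m) * of_bool (m = Suc k))
      - (\<Sum>m\<in>{1..n}. of_bool (l < m) * of_bool (m = k))"
    by (simp add: algebra_simps sum_subtractf)
  also have "(\<Sum>m\<in>{1..n}. of_bool (l < m) * of_bool (m = Suc k)) = (of_bool (l \<le> k) :: real)"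
    using assms by (subst sum.mono_neutral_right[where S = "{Suc k}"]) auto
  also have "(\<Sum>m\<in>{1..n}. of_bool (l < m) * of_bool (m = k)) = (of_bool (l < k) :: real)"
  proof (cases "k = 0")
    case False
    then show ?thesis
      using assms by (subst sum.mono_neutral_right[where S = "{k}"]) auto
  qed auto
  finally show ?thesis by auto
qed

lemma threshold_step_coeff:
  assumes "i < n" "j < n"
  shows "(\<Sum>k<n. of_bool (k < s i) * step_coeff k j) = of_bool (i = j)"
proof -
  obtain r where r: "s j = Suc r" using rank_pos[OF assms(2)] by (cases "s j") auto
  have "r < n" using rank_le[OF assms(2)] r by simp
  have "(\<Sum>k<n. of_bool (k < s i) * step_coeff k j) =
      (\<Sum>k<n. of_bool (k < s i) * of_bool (r = k))
      - (\<Sum>k<n. of_bool (k < s i) * of_bool (Suc r = k))"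
    unfolding step_coeff_def r by (simp add: right_diff_distrib sum_subtractf
        del: sum_of_bool_mult_eq sum_mult_of_bool_eq)
  also have "(\<Sum>k<n. of_bool (k < s i) * of_bool (r = k)) = (of_bool (r < s i) :: real)"
    using \<open>r < n\<close> by (subst sum.mono_neutral_right[where S = "{r}"]) auto
  also have "(\<Sum>k<n. of_bool (k < s i) * of_bool (Suc r = k)) = (of_bool (Suc r < s i) :: real)"
  proof (cases "Suc r < n")
    case True
    then show ?thesis by (subst sum.mono_neutral_right[where S = "{Suc r}"]) auto
  next
    case False
    then show ?thesis using rank_le[OF assms(1)] by (auto intro!: sum.neutral)
  qed
  finally show ?thesis using rank_inj[OF assms] r by (auto simp: Suc_lessI)
qed

text \<open>
  The test vector \<open>step_coeff k\<close> switches off all squares but the one with the factor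
  \<open>g (Suc k) - g k\<close>.
\<close>

lemma psd_rank_mat_iff:
  assumes "g 0 = 0"
  shows "psd_mat (rank_mat n s g) \<longleftrightarrow> (\<forall>k<n. g k \<le> g (Suc k))"
proof
  assume psd: "psd_mat (rank_mat n s g)"
  show "\<forall>k<n. g k \<le> g (Suc k)"
  proof (intro allI impI)
    fix k assume k: "k < n"
    let ?v = "vec n (step_coeff k)"
    have "0 \<le> ?v \<bullet> (rank_mat n s g *\<^sub>v ?v)"
      using psd by (simp add: psd_mat_def)
    also have "\<dots> = (\<Sum>l<n. (g (Suc l) - g l) * (of_bool (l = k))\<^sup>2)"
      using k by (simp add: rank_mat_quadratic_form[where g = g, OF assms] step_coeff_threshold
          del: sum_of_bool_mult_eq sum_mult_of_bool_eq)
    also have "\<dots> = g (Suc k) - g k"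
      using k by (subst sum.mono_neutral_right[where S = "{k}"]) auto
    finally show "g k \<le> g (Suc k)" by simp
  qed
next
  assume "\<forall>k<n. g k \<le> g (Suc k)"
  then show "psd_mat (rank_mat n s g)"
    unfolding psd_mat_def
    by (auto simp: rank_mat_quadratic_form[where g = g, OF assms] intro!: sum_nonneg mult_nonneg_nonneg)
qed

lemma loewner_le_rank_mat_iff:
  assumes "g 0 = 0" "h 0 = 0"
  shows "rank_mat n s g \<preceq>\<^sub>L rank_mat n s h \<longleftrightarrow> (\<forall>k<n. g (Suc k) - g k \<le> h (Suc k) - h k)"
  using assms by (auto simp: loewner_le_def diff_rank_mat psd_rank_mat_iff algebra_simps)

end

section \<open>Inverse M-matrices\<close>

text \<open>
  An M-matrix \<open>B\<close> that inverts \<open>A\<close> has \<open>A\<close> itself as its entrywise nonnegative inverse, so the two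
  nested existential statements collapse to one matrix \<open>B\<close>.
\<close>

lemma nonsingular_inverse_M_matD:
  assumes "A \<in> carrier_mat n n" "nonsingular_inverse_M_mat A"
  obtains B where "B \<in> carrier_mat n n" "A * B = 1\<^sub>m n" "Z_mat B" "entrywise_nonneg A"
proof -
  obtain B C where B: "is_inverse_mat A B" "Z_mat B" and C: "is_inverse_mat B C" "entrywise_nonneg C"
    using assms(2) by (auto simp: nonsingular_inverse_M_mat_def nonsingular_M_mat_def)
  have AB: "A * B = 1\<^sub>m n" and BA: "B * A = 1\<^sub>m (dim_row B)"
    using B assms(1) by (auto simp: is_inverse_mat_def inverts_mat_def)
  have Bn: "B \<in> carrier_mat n n"
    using arg_cong[OF AB, of dim_col] arg_cong[OF BA, of dim_col] assms(1) by auto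
  have BC: "B * C = 1\<^sub>m n" and CB: "C * B = 1\<^sub>m (dim_row C)"
    using C Bn by (auto simp: is_inverse_mat_def inverts_mat_def)
  have Cn: "C \<in> carrier_mat n n"
    using arg_cong[OF BC, of dim_col] arg_cong[OF CB, of dim_col] Bn by auto
  have "A = A * (B * C)" using BC assms(1) by simp
  also have "\<dots> = C" using assms(1) Bn Cn AB by (simp flip: assoc_mult_mat)
  finally show thesis using that Bn AB B C by simp
qed

lemma nonsingular_inverse_M_matI:
  assumes "A \<in> carrier_mat n n" "B \<in> carrier_mat n n" "A * B = 1\<^sub>m n" "Z_mat B" "entrywise_nonneg A"
  shows "nonsingular_inverse_M_mat A"
proof -
  have "B * A = 1\<^sub>m n" using mat_mult_left_right_inverse[OF assms(1-3)] .
  then show ?thesis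
    using assms
    by (auto simp: nonsingular_inverse_M_mat_def nonsingular_M_mat_def is_inverse_mat_def
        inverts_mat_def)
qed

text \<open>
  Let \<open>B\<close> be the inverse. The rows of the matrix at positions \<open>k + 1\<close> and \<open>k\<close> differ by
  \<open>g (Suc k) - g k\<close> on the columns beyond \<open>k\<close> and agree elsewhere. Multiplied with the column of \<open>B\<close> at
  position \<open>k\<close>, this difference gives \<open>-1\<close>, while the entries of \<open>B\<close> involved are off the diagonal
  and hence nonpositive: the increment is positive. The first increment is itself an entry, hence
  nonnegative, and it cannot be 0 since it fills a row. Conversely, positive increments can be inverted
  in the diagonalization, and two distinct unit vectors never contribute with equal signs to the same
  \<open>step_coeff k\<close>, which makes the inverse a Z-matrix.
\<close>

lemma (in ranking) inverse_M_rank_mat_iff: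
  assumes g0: "g 0 = 0"
  shows "nonsingular_inverse_M_mat (rank_mat n s g) \<longleftrightarrow> (\<forall>k<n. g k < g (Suc k))"
proof
  assume "nonsingular_inverse_M_mat (rank_mat n s g)"
  then obtain B where B: "B \<in> carrier_mat n n" and AB: "rank_mat n s g * B = 1\<^sub>m n"
    and Z: "Z_mat B" and nonneg: "entrywise_nonneg (rank_mat n s g)"
    using nonsingular_inverse_M_matD[OF rank_mat_carrier] by metis
  have row: "(\<Sum>l<n. g (min (s i) (s l)) * B $$ (l, j)) = of_bool (i = j)"
    if "i < n" "j < n" for i j
  proof -
    have "(\<Sum>l<n. g (min (s i) (s l)) * B $$ (l, j)) = (rank_mat n s g * B) $$ (i, j)"
      using that B by (simp add: scalar_prod_def flip: lessThan_atLeast0)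
    then show ?thesis using that AB by simp
  qed
  show "\<forall>k<n. g k < g (Suc k)"
  proof (intro allI impI)
    fix k assume k: "k < n"
    obtain i where i: "i < n" "s i = Suc k" using k rank_surj[of "Suc k"] by auto
    have diff: "g (min (Suc k) (s l)) - g (min k (s l)) = (g (Suc k) - g k) * of_bool (k < s l)" for l
      by (cases "k < s l") (auto simp: min_def not_less_eq_eq)
    show "g k < g (Suc k)"
    proof (cases "k = 0")
      case True
      have "0 \<le> g 1"
        using nonneg i True by (auto simp: entrywise_nonneg_def dest!: spec[of _ i])
      moreover have "g 1 \<noteq> 0"
      proof
        assume "g 1 = 0"
        then have "g (min (s i) (s l)) = 0" for l
          using i True g0 by (cases "s l") auto
        then show False using row[OF i(1) i(1)] by simp
      qed
      ultimately show ?thesis using True g0 by simp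
    next
      case False
      obtain j where j: "j < n" "s j = k" using False k rank_surj[of k] by auto
      let ?t = "\<Sum>l<n. of_bool (k < s l) * B $$ (l, j)"
      have "(g (Suc k) - g k) * ?t =
          (\<Sum>l<n. (g (min (Suc k) (s l)) - g (min k (s l))) * B $$ (l, j))"
        by (simp only: diff sum_distrib_left mult.assoc)
      also have "\<dots> = -1"
        using row[OF i(1) j(1)] row[OF j(1) j(1)] i j
        by (auto simp: left_diff_distrib sum_subtractf)
      finally have "(g (Suc k) - g k) * ?t = -1" .
      moreover have "?t \<le> 0"
      proof (intro sum_nonpos)
        fix l assume "l \<in> {..<n}"
        then show "of_bool (k < s l) * B $$ (l, j) \<le> 0"
          using Z B j by (auto simp: Z_mat_def)
      qed
      ultimately show ?thesis
        by (smt (verit) mult_nonpos_nonpos)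
    qed
  qed
next
  assume inc: "\<forall>k<n. g k < g (Suc k)"
  define d where "d k = g (Suc k) - g k" for k
  have d: "0 < d k" if "k < n" for k using inc that by (simp add: d_def)
  \<comment> \<open>The inverse of the threshold factorization: \<open>step_coeff\<close> on both sides of the diagonal matrix
    of the reciprocals \<open>1 / d k\<close>.\<close>
  define B where "B = mat n n (\<lambda>(i, j). \<Sum>k<n. step_coeff k i * step_coeff k j / d k)"
  have B: "B \<in> carrier_mat n n" by (simp add: B_def)
  have "rank_mat n s g * B = 1\<^sub>m n"
  proof (rule eq_matI)
    fix i j assume "i < dim_row (1\<^sub>m n :: real mat)" "j < dim_col (1\<^sub>m n :: real mat)"
    then have ij: "i < n" "j < n" by auto
    have "(rank_mat n s g * B) $$ (i, j) =
        (\<Sum>l<n. g (min (s i) (s l)) * (\<Sum>k<n. step_coeff k l * step_coeff k j / d k))"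
      using ij B by (simp add: scalar_prod_def B_def flip: lessThan_atLeast0)
    also have "\<dots> = (\<Sum>l<n. \<Sum>m<n. \<Sum>k<n. d m * of_bool (m < s i) * (step_coeff k j / d k)
        * (of_bool (m < s l) * step_coeff k l))"
    proof (intro sum.cong refl)
      fix l assume "l \<in> {..<n}"
      then have "g (min (s i) (s l)) = (\<Sum>m<n. d m * (of_bool (m < s i) * of_bool (m < s l)))"
        unfolding d_def using ij by (intro rank_mat_entry[where g = g, OF g0]) auto
      then show "g (min (s i) (s l)) * (\<Sum>k<n. step_coeff k l * step_coeff k j / d k) =
          (\<Sum>m<n. \<Sum>k<n. d m * of_bool (m < s i) * (step_coeff k j / d k)
            * (of_bool (m < s l) * step_coeff k l))"
        by (simp only: sum_product) (simp add: mult_ac del: sum_of_bool_mult_eq sum_mult_of_bool_eq)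
    qed
    also have "\<dots> = (\<Sum>m<n. \<Sum>l<n. \<Sum>k<n. d m * of_bool (m < s i) * (step_coeff k j / d k)
        * (of_bool (m < s l) * step_coeff k l))"
      by (rule sum.swap)
    also have "\<dots> = (\<Sum>m<n. \<Sum>k<n. \<Sum>l<n. d m * of_bool (m < s i) * (step_coeff k j / d k)
        * (of_bool (m < s l) * step_coeff k l))"
      by (intro sum.cong refl sum.swap)
    also have "\<dots> = (\<Sum>m<n. \<Sum>k<n. d m * of_bool (m < s i) * (step_coeff k j / d k)
        * of_bool (m = k))"
      by (intro sum.cong refl)
        (simp only: sum_distrib_left[symmetric] step_coeff_threshold lessThan_iff)
    also have "\<dots> = (\<Sum>m<n. of_bool (m < s i) * step_coeff m j)"
    proof (intro sum.cong refl)
      fix m assume "m \<in> {..<n}"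
      then show "(\<Sum>k<n. d m * of_bool (m < s i) * (step_coeff k j / d k) * of_bool (m = k)) =
          of_bool (m < s i) * step_coeff m j"
        using d[of m] by (subst sum.mono_neutral_right[where S = "{m}"]) auto
    qed
    also have "\<dots> = of_bool (i = j)" using ij by (rule threshold_step_coeff)
    finally show "(rank_mat n s g * B) $$ (i, j) = 1\<^sub>m n $$ (i, j)" using ij by simp
  qed (use B in auto)
  moreover have "Z_mat B"
  proof -
    have "step_coeff k i * step_coeff k j / d k \<le> 0" if "i < n" "j < n" "i \<noteq> j" "k < n" for i j k
    proof -
      have "step_coeff k i * step_coeff k j \<le> 0"
        using rank_inj[of i j] that by (auto simp: step_coeff_def)
      then show ?thesis using d[OF that(4)] by (simp add: divide_nonpos_pos)
    qed
    then show ?thesis by (auto simp: Z_mat_def B_def intro!: sum_nonpos)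
  qed
  moreover have "entrywise_nonneg (rank_mat n s g)"
    unfolding entrywise_nonneg_def
  proof (intro allI impI)
    fix i j assume "i < dim_row (rank_mat n s g)" "j < dim_col (rank_mat n s g)"
    then have ij: "i < n" "j < n" by auto
    then show "0 \<le> rank_mat n s g $$ (i, j)"
      using levels_mono[of n g 0 "min (s i) (s j)"] inc g0 rank_le[of i]
      by (auto simp: less_imp_le min.coboundedI1)
  qed
  ultimately show "nonsingular_inverse_M_mat (rank_mat n s g)"
    by (intro nonsingular_inverse_M_matI[OF rank_mat_carrier B])
qed

section \<open>Total nonnegativity\<close>

lemma det_simultaneous_permutation:
  fixes A :: "real mat"
  assumes A: "A \<in> carrier_mat m m" and p: "p permutes {0..<m}"
  shows "det (mat m m (\<lambda>(i, j). A $$ (p i, p j))) = det A"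
proof -
  let ?R = "mat m m (\<lambda>(i, j). A $$ (p i, j))"
  have R: "?R\<^sup>T \<in> carrier_mat m m" by simp
  have pm: "p i < m" if "i < m" for i using permutes_in_image[OF p, of i] that by simp
  have "det (mat m m (\<lambda>(i, j). A $$ (p i, p j))) = det (mat m m (\<lambda>(i, j). A $$ (p i, p j)))\<^sup>T"
    by (rule det_transpose[symmetric, of _ m]) simp
  also have "(mat m m (\<lambda>(i, j). A $$ (p i, p j)))\<^sup>T = mat m m (\<lambda>(i, j). ?R\<^sup>T $$ (p i, j))"
    using pm by (intro eq_matI) auto
  also have "det \<dots> = signof p * det ?R\<^sup>T" by (rule det_permute_rows[OF R p])
  also have "det ?R\<^sup>T = det ?R" by (rule det_transpose[of _ m]) simp
  also have "det ?R = signof p * det A" by (rule det_permute_rows[OF A p])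
  finally show ?thesis by (simp add: sign_def)
qed

text \<open>
  Subtracting the first column of a matrix \<open>min x y\<close> leaves a matrix of the same kind.
\<close>

lemma min_diff_min:
  fixes x y z :: real
  shows "z \<le> y \<Longrightarrow> min x y - min x z = min (max (x - z) 0) (y - z)"
  by (auto simp: min_def max_def)

text \<open>
  If \<open>a 0 \<le> b 0\<close>, the first row is constant, equal to \<open>a 0\<close>. Subtracting the first column from the
  others clears the rest of that row, and by \<open>min_diff_min\<close> the remaining minor is of the same form
  with the monotone sequences \<open>max (a (Suc i) - b 0) 0\<close> and \<open>b (Suc j) - b 0\<close>. Otherwise the transpose
  is in that situation.
\<close>

lemma det_min_mono_nonneg:
  fixes a b :: "nat \<Rightarrow> real"
  assumes "\<And>i. i < m \<Longrightarrow> 0 \<le> a i" "\<And>i. i < m \<Longrightarrow> 0 \<le> b i"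
    and "mono_on {..<m} a" "mono_on {..<m} b"
  shows "0 \<le> det (mat m m (\<lambda>(i, j). min (a i) (b j)))"
  using assms
proof (induction m arbitrary: a b)
  case 0
  then show ?case by simp
next
  case (Suc m)
  have first_row: "0 \<le> det (mat (Suc m) (Suc m) (\<lambda>(i, j). min (a i) (b j)))"
    if a: "\<And>i. i < Suc m \<Longrightarrow> 0 \<le> a i" and ma: "mono_on {..<Suc m} a" and mb: "mono_on {..<Suc m} b"
      and ab: "a 0 \<le> b 0" for a b :: "nat \<Rightarrow> real"
  proof -
    let ?A = "mat (Suc m) (Suc m) (\<lambda>(i, j). min (a i) (b j))"
    \<comment> \<open>Multiplication by the unitriangular matrix \<open>?U\<close> subtracts column 0 from all other columns.\<close>
    let ?U = "mat (Suc m) (Suc m) (\<lambda>(i, j). of_bool (i = j) - of_bool (i = 0 \<and> 0 < j) :: real)"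
    let ?A' = "mat (Suc m) (Suc m)
        (\<lambda>(i, j). if j = 0 then min (a i) (b 0) else min (a i) (b j) - min (a i) (b 0))"
    let ?S = "mat m m (\<lambda>(i, j). min (max (a (Suc i) - b 0) 0) (b (Suc j) - b 0))"
    have b0: "b 0 \<le> b j" if "j < Suc m" for j using that mb by (auto dest: monotone_onD)
    have "det ?U = 1"
    proof (subst det_upper_triangular[where n = "Suc m"])
      show "prod_list (diag_mat ?U) = 1"
        by (auto simp: prod_list_diag_prod intro!: prod.neutral)
    qed auto
    moreover have "?A * ?U = ?A'"
    proof (rule eq_matI)
      fix i j assume "i < dim_row ?A'" "j < dim_col ?A'"
      then have ij: "i < Suc m" "j < Suc m" by auto
      have "(?A * ?U) $$ (i, j) =
          (\<Sum>k<Suc m. min (a i) (b k) * (of_bool (k = j) - of_bool (k = 0 \<and> 0 < j)))"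
        using ij by (simp add: scalar_prod_def flip: lessThan_atLeast0 del: sum.lessThan_Suc)
      also have "\<dots> = (\<Sum>k<Suc m. min (a i) (b k) * of_bool (k = j))
          - (\<Sum>k<Suc m. min (a i) (b k) * of_bool (k = 0 \<and> 0 < j))"
        by (simp add: right_diff_distrib sum_subtractf del: sum.lessThan_Suc
            sum_of_bool_mult_eq sum_mult_of_bool_eq)
      also have "(\<Sum>k<Suc m. min (a i) (b k) * of_bool (k = j)) = min (a i) (b j)"
        using ij by (subst sum.mono_neutral_right[where S = "{j}"]) auto
      also have "(\<Sum>k<Suc m. min (a i) (b k) * of_bool (k = 0 \<and> 0 < j)) =
          min (a i) (b 0) * of_bool (0 < j)"
        by (subst sum.mono_neutral_right[where S = "{0}"]) auto
      finally show "(?A * ?U) $$ (i, j) = ?A' $$ (i, j)" using ij by auto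
    qed auto
    ultimately have "det ?A = det ?A'"
      using det_mult[of ?A "Suc m" ?U] by simp
    also have "\<dots> = (\<Sum>j<Suc m. ?A' $$ (0, j) * cofactor ?A' 0 j)"
      by (rule laplace_expansion_row) auto
    also have "\<dots> = a 0 * cofactor ?A' 0 0"
      using order_trans[OF ab b0] ab
      by (subst sum.mono_neutral_right[where S = "{0}"]) (auto simp: min_absorb1)
    also have "cofactor ?A' 0 0 = det ?S"
    proof -
      have "mat_delete ?A' 0 0 = ?S"
        by (intro eq_matI) (simp_all add: mat_delete_def min_diff_min b0)
      then show ?thesis by (simp add: cofactor_def)
    qed
    also have "0 \<le> a 0 * det ?S"
    proof (intro mult_nonneg_nonneg Suc.IH)
      show "mono_on {..<m} (\<lambda>i. max (a (Suc i) - b 0) 0)"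
        by (intro monotone_onI max.mono diff_right_mono monotone_onD[OF ma]) auto
      show "mono_on {..<m} (\<lambda>j. b (Suc j) - b 0)"
        by (intro monotone_onI diff_right_mono monotone_onD[OF mb]) auto
    qed (use a b0 in auto)
    finally show ?thesis .
  qed
  show ?case
  proof (cases "a 0 \<le> b 0")
    case True
    then show ?thesis using Suc.prems by (intro first_row)
  next
    case False
    have "det (mat (Suc m) (Suc m) (\<lambda>(i, j). min (a i) (b j))) =
        det (mat (Suc m) (Suc m) (\<lambda>(i, j). min (a i) (b j)))\<^sup>T"
      by (rule det_transpose[symmetric, of _ "Suc m"]) simp
    also have "(mat (Suc m) (Suc m) (\<lambda>(i, j). min (a i) (b j)))\<^sup>T =
        mat (Suc m) (Suc m) (\<lambda>(i, j). min (b i) (a j))"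
      by (auto simp: min.commute)
    also have "0 \<le> det \<dots>" using Suc.prems False by (intro first_row) auto
    finally show ?thesis .
  qed
qed

text \<open>
  Reversing rows and columns together keeps the determinant and turns decreasing sequences into
  increasing ones.
\<close>

lemma det_min_antimono_nonneg:
  fixes a b :: "nat \<Rightarrow> real"
  assumes "\<And>i. i < m \<Longrightarrow> 0 \<le> a i" "\<And>i. i < m \<Longrightarrow> 0 \<le> b i"
    and anti: "antimono_on {..<m} a" "antimono_on {..<m} b"
  shows "0 \<le> det (mat m m (\<lambda>(i, j). min (a i) (b j)))"
proof -
  let ?A = "mat m m (\<lambda>(i, j). min (a i) (b j))"
  define p where "p i = (if i < m then m - Suc i else i)" for i
  have p: "p permutes {0..<m}"
  proof (rule bij_imp_permutes)
    show "bij_betw p {0..<m} {0..<m}"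
      by (rule bij_betwI[where g = p]) (auto simp: p_def)
  qed (auto simp: p_def)
  have "det ?A = det (mat m m (\<lambda>(i, j). ?A $$ (p i, p j)))"
    by (rule det_simultaneous_permutation[OF _ p, symmetric]) simp
  also have "mat m m (\<lambda>(i, j). ?A $$ (p i, p j)) = mat m m (\<lambda>(i, j). min (a (p i)) (b (p j)))"
    by (intro eq_matI) (auto simp: p_def)
  also have "0 \<le> det \<dots>"
  proof (rule det_min_mono_nonneg)
    show "mono_on {..<m} (\<lambda>i. a (p i))" "mono_on {..<m} (\<lambda>i. b (p i))"
      using anti by (auto simp: p_def intro!: monotone_onI elim!: monotone_onD)
  qed (use assms in \<open>auto simp: p_def\<close>)
  finally show ?thesis .
qed

text \<open>
  Nondecreasing \<open>g\<close> commute with \<open>min\<close>, so a minor has the entries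
  \<open>min (g (s (pick I i))) (g (s (pick J j)))\<close>. Both sequences go up (Min) or both go down (Max).
\<close>

lemma (in ranking) totally_nonneg_rank_mat:
  assumes g0: "g 0 = 0" and inc: "\<forall>k<n. g k \<le> g (Suc k)"
  shows "totally_nonneg (rank_mat n s g)"
  unfolding totally_nonneg_def
proof (intro allI impI, elim conjE)
  fix I J assume "I \<subseteq> {..<dim_row (rank_mat n s g)}" "J \<subseteq> {..<dim_col (rank_mat n s g)}"
    and card: "card I = card J"
  then have IJ: "I \<subseteq> {..<n}" "J \<subseteq> {..<n}" by auto
  let ?m = "card I"
  have pick: "pick K i < n" if "K \<subseteq> {..<n}" "i < card K" for K i
    using pick_in_set_le[of i K] that by auto
  have pick_mono: "pick K i \<le> pick K j" if "i \<le> j" "j < card K" for K i j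
    using that pick_mono_le[of j K i] by (cases "i = j") auto
  have nonneg: "0 \<le> g (s i)" if "i < n" for i
    using levels_mono[OF inc, of 0 "s i"] g0 rank_le[OF that] by simp
  let ?a = "\<lambda>K i. g (s (pick K i))"
  have "g (min (s i) (s j)) = min (g (s i)) (g (s j))" if "i < n" "j < n" for i j
    using levels_mono[OF inc, of "s i" "s j"] levels_mono[OF inc, of "s j" "s i"]
      rank_le[OF that(1)] rank_le[OF that(2)] by (auto simp: min_def)
  moreover have "{i. i < n \<and> i \<in> I} = I" "{i. i < n \<and> i \<in> J} = J" using IJ by auto
  ultimately have "submatrix (rank_mat n s g) I J = mat ?m ?m (\<lambda>(i, j). min (?a I i) (?a J j))"
    using pick[OF IJ(1)] pick[OF IJ(2)] card by (intro eq_matI) (auto simp: submatrix_def)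
  also have "0 \<le> det \<dots>"
    using monotone
  proof
    assume s: "mono_on {..<n} s"
    have "mono_on {..<card K} (?a K)" if "K \<subseteq> {..<n}" for K
      using pick[OF that] pick_mono[of _ _ K]
      by (auto intro!: monotone_onI levels_mono[OF inc] rank_le monotone_onD[OF s])
    from this[OF IJ(1)] this[OF IJ(2)]
    have "mono_on {..<?m} (?a I)" "mono_on {..<?m} (?a J)" by (simp_all add: card)
    then show ?thesis
      by (intro det_min_mono_nonneg) (use card nonneg pick[OF IJ(1)] pick[OF IJ(2)] in auto)
  next
    assume s: "antimono_on {..<n} s"
    have "antimono_on {..<card K} (?a K)" if "K \<subseteq> {..<n}" for K
      using pick[OF that] pick_mono[of _ _ K]
      by (auto intro!: monotone_onI levels_mono[OF inc] rank_le monotone_onD[OF s])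
    from this[OF IJ(1)] this[OF IJ(2)]
    have "antimono_on {..<?m} (?a I)" "antimono_on {..<?m} (?a J)" by (simp_all add: card)
    then show ?thesis
      by (intro det_min_antimono_nonneg) (use card nonneg pick[OF IJ(1)] pick[OF IJ(2)] in auto)
  qed
  finally show "0 \<le> det (submatrix (rank_mat n s g) I J)" .
qed

section \<open>The Min and Max classes in terms of levels\<close>

definition rank_class :: "(real \<Rightarrow> real \<Rightarrow> bool) \<Rightarrow> nat \<Rightarrow> (nat \<Rightarrow> nat) \<Rightarrow> real mat set" where
  "rank_class R n s = {rank_mat n s g | g. g 0 = 0 \<and> (\<forall>k<n. R (g k) (g (Suc k)))}"

text \<open>
  Vectors and sequences \<open>g\<close> with \<open>g 0 = 0\<close> correspond to each other along the bijection \<open>s\<close>. This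
  lemma transfers all six classes of matrices, described by vectors, to descriptions by levels.
\<close>

lemma (in ranking) image_of_vectors_eq_image_of_levels:
  assumes "\<And>x g. \<lbrakk>x \<in> carrier_vec n; g 0 = 0; \<And>i. i < n \<Longrightarrow> g (s i) = x $ i\<rbrakk>
    \<Longrightarrow> M x = rank_mat n s g \<and> (P x \<longleftrightarrow> Q g)"
  shows "{M x | x. x \<in> carrier_vec n \<and> P x} = {rank_mat n s g | g. g 0 = 0 \<and> Q g}"
proof (intro Set.equalityI subsetI)
  fix A assume "A \<in> {M x | x. x \<in> carrier_vec n \<and> P x}"
  then obtain x where x: "A = M x" "x \<in> carrier_vec n" "P x" by blast
  define g where "g k = (if k = 0 then 0 else x $ (inv_into {..<n} s k))" for k
  have "g (s i) = x $ i" if "i < n" for i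
    using bij_betw_inv_into_left[OF bij, of i] rank_pos[OF that] that by (simp add: g_def)
  then have "A = rank_mat n s g" "Q g" "g 0 = 0"
    using assms[of x g] x by (auto simp: g_def)
  then show "A \<in> {rank_mat n s g | g. g 0 = 0 \<and> Q g}" by blast
next
  fix A assume "A \<in> {rank_mat n s g | g. g 0 = 0 \<and> Q g}"
  then obtain g where g: "A = rank_mat n s g" "g 0 = 0" "Q g" by blast
  then have "A = M (vec n (\<lambda>i. g (s i)))" "P (vec n (\<lambda>i. g (s i)))"
    using assms[of "vec n (\<lambda>i. g (s i))" g] by auto
  then show "A \<in> {M x | x. x \<in> carrier_vec n \<and> P x}" by force
qed

lemma sorted_wrt_levels:
  assumes "transp R" "length ys = n" "g 0 = 0" "\<And>k. k < n \<Longrightarrow> ys ! k = g (Suc k)"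
  shows "sorted_wrt R (0 # ys) \<longleftrightarrow> (\<forall>k<n. R (g k) (g (Suc k)))"
proof -
  have "(0 # ys) ! k = g k" if "k \<le> n" for k
    using assms that by (cases k) auto
  then show ?thesis
    unfolding sorted_wrt_iff_nth_Suc_transp[OF assms(1)] using assms(2,4) by auto
qed

lemma min_mat_eq_rank_mat:
  assumes "x \<in> carrier_vec n" "\<And>i. i < n \<Longrightarrow> g (Suc i) = x $ i"
  shows "min_mat x = rank_mat n Suc g"
  using assms by (intro eq_matI) (auto simp: min_mat_def min_def)

lemma max_mat_eq_rank_mat:
  assumes "x \<in> carrier_vec n" "\<And>i. i < n \<Longrightarrow> g (n - i) = x $ i"
  shows "max_mat x = rank_mat n (\<lambda>i. n - i) g"
proof -
  have "min (n - i) (n - j) = n - max i j" for i j by simp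
  then show ?thesis using assms by (intro eq_matI) (auto simp: max_mat_def)
qed

lemma sorted_min_mats:
  assumes "transp R"
  shows "{min_mat x | x. x \<in> carrier_vec n \<and> sorted_wrt R (0 # list_of_vec x)} = rank_class R n Suc"
  unfolding rank_class_def
  by (intro ranking.image_of_vectors_eq_image_of_levels[OF ranking_Suc] conjI
      min_mat_eq_rank_mat sorted_wrt_levels[OF assms]) (auto simp: list_of_vec_index)

lemma sorted_max_mats:
  assumes "transp R"
  shows "{max_mat x | x. x \<in> carrier_vec n \<and> sorted_wrt (\<lambda>a b. R b a) (list_of_vec x @ [0])} =
    rank_class R n (\<lambda>i. n - i)"
  unfolding rank_class_def
proof (intro ranking.image_of_vectors_eq_image_of_levels[OF ranking_reverse] conjI
      max_mat_eq_rank_mat)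
  fix x and g :: "nat \<Rightarrow> real"
  assume x: "x \<in> carrier_vec n" and g: "g 0 = 0" "\<And>i. i < n \<Longrightarrow> g (n - i) = x $ i"
  have "sorted_wrt (\<lambda>a b. R b a) (list_of_vec x @ [0]) \<longleftrightarrow> sorted_wrt R (0 # rev (list_of_vec x))"
    using sorted_wrt_rev[of R "list_of_vec x @ [0]"]
    by (simp only: rev_append rev.simps append_Nil append_Cons)
  also have "\<dots> \<longleftrightarrow> (\<forall>k<n. R (g k) (g (Suc k)))"
  proof (rule sorted_wrt_levels[where g = g, OF assms _ g(1)])
    fix k assume "k < n"
    then show "rev (list_of_vec x) ! k = g (Suc k)"
      using x g(2)[of "n - Suc k"] by (simp add: rev_nth list_of_vec_index)
  qed (use x in simp)
  finally show "sorted_wrt (\<lambda>a b. R b a) (list_of_vec x @ [0]) \<longleftrightarrow> (\<forall>k<n. R (g k) (g (Suc k)))" .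
qed auto

lemma min_cone_eq: "min_cone n = rank_class (\<le>) n Suc"
  unfolding min_cone_def by (rule sorted_min_mats) simp

lemma strict_min_class_eq: "strict_min_class n = rank_class (<) n Suc"
  unfolding strict_min_class_def by (rule sorted_min_mats) simp

lemma max_cone_eq: "max_cone n = rank_class (\<le>) n (\<lambda>i. n - i)"
  unfolding max_cone_def by (rule sorted_max_mats) simp

lemma strict_max_class_eq: "strict_max_class n = rank_class (<) n (\<lambda>i. n - i)"
  unfolding strict_max_class_def by (rule sorted_max_mats) simp

lemma inverse_M_min_class_eq: "inverse_M_min_class n = rank_class (<) n Suc"
  unfolding inverse_M_min_class_def rank_class_def
proof (rule ranking.image_of_vectors_eq_image_of_levels[OF ranking_Suc])
  fix x and g :: "nat \<Rightarrow> real"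
  assume "x \<in> carrier_vec n" "g 0 = 0" "\<And>i. i < n \<Longrightarrow> g (Suc i) = x $ i"
  moreover from this have "min_mat x = rank_mat n Suc g" by (intro min_mat_eq_rank_mat) auto
  ultimately show "min_mat x = rank_mat n Suc g \<and>
      (nonsingular_inverse_M_mat (min_mat x) \<longleftrightarrow> (\<forall>k<n. g k < g (Suc k)))"
    using ranking.inverse_M_rank_mat_iff[OF ranking_Suc, of g] by simp
qed

lemma inverse_M_max_class_eq: "inverse_M_max_class n = rank_class (<) n (\<lambda>i. n - i)"
  unfolding inverse_M_max_class_def rank_class_def
proof (rule ranking.image_of_vectors_eq_image_of_levels[OF ranking_reverse])
  fix x and g :: "nat \<Rightarrow> real"
  assume "x \<in> carrier_vec n" "g 0 = 0" "\<And>i. i < n \<Longrightarrow> g ((\<lambda>i. n - i) i) = x $ i"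
  moreover from this have "max_mat x = rank_mat n (\<lambda>i. n - i) g" by (intro max_mat_eq_rank_mat) auto
  ultimately show "max_mat x = rank_mat n (\<lambda>i. n - i) g \<and>
      (nonsingular_inverse_M_mat (max_mat x) \<longleftrightarrow> (\<forall>k<n. g k < g (Suc k)))"
    using ranking.inverse_M_rank_mat_iff[OF ranking_reverse, of g] by simp
qed

lemma min_max_cones_cases:
  assumes "C \<in> min_max_cones"
  obtains n s where "ranking n s" "C = rank_class (\<le>) n s"
  using assms ranking_Suc ranking_reverse
  by (auto simp: min_max_cones_def min_cone_eq max_cone_eq)

lemma rank_class_levelsE:
  assumes "A \<in> rank_class (\<le>) n s"
  obtains g where "A = rank_mat n s g" "g 0 = 0" "\<forall>k<n. g k \<le> g (Suc k)" "\<And>k. k \<le> n \<Longrightarrow> 0 \<le> g k"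
proof -
  obtain g where g: "A = rank_mat n s g" "g 0 = 0" "\<forall>k<n. g k \<le> g (Suc k)"
    using assms by (auto simp: rank_class_def)
  moreover have "0 \<le> g k" if "k \<le> n" for k using levels_mono[OF g(3), of 0 k] that g(2) by simp
  ultimately show thesis using that by blast
qed

section \<open>Convexity inequalities in terms of levels\<close>

context ranking
begin

lemma convex_ineq_rank_mat_iff:
  assumes "f 0 = 0" "g 0 = 0" "h 0 = 0"
  shows "loewner_convex_ineq f (rank_mat n s g) (rank_mat n s h) l \<longleftrightarrow>
    (\<forall>k<n. jensen_gap f l (g k) (h k) \<le> jensen_gap f l (g (Suc k)) (h (Suc k)))"
  unfolding loewner_convex_ineq_def combination_rank_mat map_rank_mat
  by (subst loewner_le_rank_mat_iff) (auto simp: assms jensen_gap_def algebra_simps)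

lemma concave_ineq_rank_mat_iff:
  assumes "f 0 = 0" "g 0 = 0" "h 0 = 0"
  shows "loewner_concave_ineq f (rank_mat n s g) (rank_mat n s h) l \<longleftrightarrow>
    (\<forall>k<n. jensen_gap f l (g (Suc k)) (h (Suc k)) \<le> jensen_gap f l (g k) (h k))"
  unfolding loewner_concave_ineq_def combination_rank_mat map_rank_mat
  by (subst loewner_le_rank_mat_iff) (auto simp: assms jensen_gap_def algebra_simps)

text \<open>
  Increments are summed from the common value 0, so comparable matrices have comparable levels.
\<close>

lemma levels_le_if_loewner_le:
  assumes "g 0 = 0" "h 0 = 0" "rank_mat n s g \<preceq>\<^sub>L rank_mat n s h" "k \<le> n"
  shows "g k \<le> h k"
proof -
  have "\<forall>k<n. h k - g k \<le> h (Suc k) - g (Suc k)"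
    using assms by (auto simp: loewner_le_rank_mat_iff algebra_simps)
  from levels_mono[OF this, of 0 k] show ?thesis using assms by simp
qed

end

text \<open>
  Two rows give two consecutive steps of a level sequence, from 0 to \<open>u\<close> and from \<open>u\<close> to \<open>v\<close>. That is
  enough for all necessary conditions.
\<close>

definition two_levels :: "real \<Rightarrow> real \<Rightarrow> nat \<Rightarrow> real" where
  "two_levels u v k = (if k = 0 then 0 else if k = 1 then u else v)"

abbreviation two_level_mat :: "real \<Rightarrow> real \<Rightarrow> real mat" where
  "two_level_mat u v \<equiv> rank_mat 2 Suc (two_levels u v)"

lemma all_less_2: "(\<forall>k<2. P k) \<longleftrightarrow> P 0 \<and> P (Suc 0)"
  by (auto simp: less_2_cases_iff)

lemma min_cone_2_in_cones: "min_cone 2 \<in> min_max_cones"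
  by (auto simp: min_max_cones_def)

lemma two_level_mat_in_min_cone: "0 \<le> u \<Longrightarrow> u \<le> v \<Longrightarrow> two_level_mat u v \<in> min_cone 2"
  by (auto simp: min_cone_eq rank_class_def two_levels_def all_less_2 intro!: exI[of _ "two_levels u v"])

lemma two_level_loewner_le_iff:
  "two_level_mat u v \<preceq>\<^sub>L two_level_mat u' v' \<longleftrightarrow> u \<le> u' \<and> v - u \<le> v' - u'"
  by (subst ranking.loewner_le_rank_mat_iff[OF ranking_Suc]) (auto simp: two_levels_def all_less_2)

lemma two_level_convex_ineq_iff:
  "f 0 = 0 \<Longrightarrow> loewner_convex_ineq f (two_level_mat u v) (two_level_mat u' v') l \<longleftrightarrow>
    0 \<le> jensen_gap f l u u' \<and> jensen_gap f l u u' \<le> jensen_gap f l v v'"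
  by (subst ranking.convex_ineq_rank_mat_iff[OF ranking_Suc])
    (auto simp: two_levels_def all_less_2 jensen_gap_def)

lemma two_level_concave_ineq_iff:
  "f 0 = 0 \<Longrightarrow> loewner_concave_ineq f (two_level_mat u v) (two_level_mat u' v') l \<longleftrightarrow>
    jensen_gap f l u u' \<le> 0 \<and> jensen_gap f l v v' \<le> jensen_gap f l u u'"
  by (subst ranking.concave_ineq_rank_mat_iff[OF ranking_Suc])
    (auto simp: two_levels_def all_less_2 jensen_gap_def)

section \<open>Power functions\<close>

lemma pow_fun_0 [simp]: "pow_fun \<alpha> 0 = 0"
  by (simp add: pow_fun_def)

lemma jensen_gap_pow_fun_one:
  "\<lbrakk>0 \<le> x; 0 \<le> y; 0 \<le> l; l \<le> 1\<rbrakk> \<Longrightarrow> jensen_gap (pow_fun 1) l x y = 0"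
  by (simp add: jensen_gap_def pow_fun_def)

lemma pow_fun_psd_totally_nonneg:
  assumes "0 < \<alpha>" "ranking n s" "A \<in> rank_class (\<le>) n s"
  shows "psd_mat (map_mat (pow_fun \<alpha>) A) \<and> totally_nonneg (map_mat (pow_fun \<alpha>) A)"
proof -
  interpret ranking n s by fact
  obtain g where g: "A = rank_mat n s g" "g 0 = 0" "\<forall>k<n. g k \<le> g (Suc k)"
    "\<And>k. k \<le> n \<Longrightarrow> 0 \<le> g k" using assms(3) by (rule rank_class_levelsE) blast
  have "\<forall>k<n. pow_fun \<alpha> (g k) \<le> pow_fun \<alpha> (g (Suc k))"
    using g assms(1) by (auto simp: pow_fun_def intro!: powr_mono2)
  then show ?thesis
    using g(2) by (simp add: g(1) map_rank_mat psd_rank_mat_iff totally_nonneg_rank_mat)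
qed

lemma pow_fun_preserves_strict_rank_class:
  assumes "0 < \<alpha>"
  shows "preserves_class (pow_fun \<alpha>) (rank_class (<) n s)"
  unfolding preserves_class_def
proof
  fix A assume "A \<in> rank_class (<) n s"
  then obtain g where g: "A = rank_mat n s g" "g 0 = 0" "\<forall>k<n. g k < g (Suc k)"
    by (auto simp: rank_class_def)
  have nonneg: "0 \<le> g k" if "k \<le> n" for k
    using levels_mono[of n g 0 k] that g by (simp add: less_imp_le)
  have "\<forall>k<n. pow_fun \<alpha> (g k) < pow_fun \<alpha> (g (Suc k))"
    using g nonneg assms by (auto simp: pow_fun_def intro!: powr_less_mono2)
  then show "map_mat (pow_fun \<alpha>) A \<in> rank_class (<) n s"
    using g(2) by (auto simp: rank_class_def g(1) map_rank_mat)
qed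

text \<open>
  For necessity, the levels 0, 0, 1 lie below the levels 0, 1, 2, and the last increments give
  \<open>1 \<le> 2 powr \<alpha> - 1\<close>.
\<close>

lemma preserves_loewner_order_pow_fun_iff:
  "(\<forall>C \<in> min_max_cones. preserves_loewner_order (pow_fun \<alpha>) C) \<longleftrightarrow> 1 \<le> \<alpha>"
proof
  assume "\<forall>C \<in> min_max_cones. preserves_loewner_order (pow_fun \<alpha>) C"
  then have "preserves_loewner_order (pow_fun \<alpha>) (min_cone 2)" using min_cone_2_in_cones by blast
  then have "map_mat (pow_fun \<alpha>) (two_level_mat 0 1) \<preceq>\<^sub>L map_mat (pow_fun \<alpha>) (two_level_mat 1 2)"
    using two_level_mat_in_min_cone[of 0 1] two_level_mat_in_min_cone[of 1 2]
    by (auto simp: preserves_loewner_order_def two_level_loewner_le_iff)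
  then have "\<forall>k<2. pow_fun \<alpha> (two_levels 0 1 (Suc k)) - pow_fun \<alpha> (two_levels 0 1 k)
      \<le> pow_fun \<alpha> (two_levels 1 2 (Suc k)) - pow_fun \<alpha> (two_levels 1 2 k)"
    unfolding map_rank_mat
    by (subst (asm) ranking.loewner_le_rank_mat_iff[OF ranking_Suc]) (simp_all add: two_levels_def)
  then have "2 powr 1 \<le> (2::real) powr \<alpha>"
    by (simp add: all_less_2 two_levels_def pow_fun_def)
  then show "1 \<le> \<alpha>" by (subst (asm) powr_le_cancel_iff) auto
next
  assume \<alpha>: "1 \<le> \<alpha>"
  show "\<forall>C \<in> min_max_cones. preserves_loewner_order (pow_fun \<alpha>) C"
    unfolding preserves_loewner_order_def
  proof (intro ballI impI)
    fix C A B assume C: "C \<in> min_max_cones" and AB: "A \<in> C" "B \<in> C" "A \<preceq>\<^sub>L B"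
    obtain n s where "ranking n s" and Cs: "C = rank_class (\<le>) n s"
      using C by (rule min_max_cones_cases)
    then interpret ranking n s by simp
    obtain g where g: "A = rank_mat n s g" "g 0 = 0" "\<forall>k<n. g k \<le> g (Suc k)"
      "\<And>k. k \<le> n \<Longrightarrow> 0 \<le> g k" using AB(1) Cs rank_class_levelsE by metis
    obtain h where h: "B = rank_mat n s h" "h 0 = 0"
      using AB(2) Cs rank_class_levelsE by metis
    have le: "g k \<le> h k" if "k \<le> n" for k
      using levels_le_if_loewner_le that AB(3) g(1,2) h(1,2) by blast
    have "\<forall>k<n. g (Suc k) - g k \<le> h (Suc k) - h k"
      using AB(3) g h by (simp add: loewner_le_rank_mat_iff)
    then have "\<forall>k<n. pow_fun \<alpha> (g (Suc k)) - pow_fun \<alpha> (g k) \<le> pow_fun \<alpha> (h (Suc k)) - pow_fun \<alpha> (h k)"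
      unfolding pow_fun_def using \<alpha> g le by (auto intro!: powr_increment_mono)
    then show "map_mat (pow_fun \<alpha>) A \<preceq>\<^sub>L map_mat (pow_fun \<alpha>) B"
      using g h by (simp add: map_rank_mat loewner_le_rank_mat_iff)
  qed
qed

lemma identity_convex_and_concave:
  assumes "C \<in> min_max_cones"
  shows "loewner_convex_arbitrary (pow_fun 1) C" "loewner_concave_arbitrary (pow_fun 1) C"
proof -
  obtain n s where "ranking n s" and C: "C = rank_class (\<le>) n s"
    using assms by (rule min_max_cones_cases)
  then interpret ranking n s by simp
  have "loewner_convex_ineq (pow_fun 1) A B l \<and> loewner_concave_ineq (pow_fun 1) A B l"
    if AB: "A \<in> C" "B \<in> C" and l: "l \<in> {0..1}" for A B l
  proof -
    obtain g where g: "A = rank_mat n s g" "g 0 = 0" "\<And>k. k \<le> n \<Longrightarrow> 0 \<le> g k"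
      using AB(1) C rank_class_levelsE by metis
    obtain h where h: "B = rank_mat n s h" "h 0 = 0" "\<And>k. k \<le> n \<Longrightarrow> 0 \<le> h k"
      using AB(2) C rank_class_levelsE by metis
    show ?thesis
      using g h l by (simp add: convex_ineq_rank_mat_iff concave_ineq_rank_mat_iff jensen_gap_pow_fun_one)
  qed
  then show "loewner_convex_arbitrary (pow_fun 1) C" "loewner_concave_arbitrary (pow_fun 1) C"
    by (auto simp: loewner_convex_arbitrary_def loewner_concave_arbitrary_def)
qed

lemma convex_comparable_if_arbitrary:
  "loewner_convex_arbitrary f C \<Longrightarrow> loewner_convex_comparable f C"
  by (auto simp: loewner_convex_arbitrary_def loewner_convex_comparable_def)

lemma concave_comparable_if_arbitrary:
  "loewner_concave_arbitrary f C \<Longrightarrow> loewner_concave_comparable f C"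
  by (auto simp: loewner_concave_arbitrary_def loewner_concave_comparable_def)

lemma jensen_gap_half_0: "jensen_gap (pow_fun \<alpha>) (1/2) 1 0 = 1/2 - (1/2) powr \<alpha>"
  by (simp add: jensen_gap_def pow_fun_def)

text \<open>
  Necessity uses the gap with equal weights on levels of two rows: the steps \<open>(0, 0)\<close> to \<open>(1, 0)\<close> and
  \<open>(2, 0)\<close> to \<open>(2 + s, s)\<close> are both admissible for comparable matrices.
\<close>

lemma convex_comparable_pow_fun_iff:
  assumes "0 < \<alpha>"
  shows "(\<forall>C \<in> min_max_cones. loewner_convex_comparable (pow_fun \<alpha>) C) \<longleftrightarrow> \<alpha> = 1 \<or> 2 \<le> \<alpha>"
proof
  assume "\<forall>C \<in> min_max_cones. loewner_convex_comparable (pow_fun \<alpha>) C"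
  then have "loewner_convex_comparable (pow_fun \<alpha>) (min_cone 2)" using min_cone_2_in_cones by blast
  then have gap: "0 \<le> jensen_gap (pow_fun \<alpha>) (1/2) u u' \<and>
      jensen_gap (pow_fun \<alpha>) (1/2) u u' \<le> jensen_gap (pow_fun \<alpha>) (1/2) v v'"
    if "0 \<le> u'" "u' \<le> v'" "u' \<le> u" "v' - u' \<le> v - u" for u v u' v'
    using that two_level_mat_in_min_cone[of u v] two_level_mat_in_min_cone[of u' v']
      two_level_convex_ineq_iff[of "pow_fun \<alpha>" u v u' v' "1/2"]
    by (auto simp: loewner_convex_comparable_def two_level_loewner_le_iff)
  have "1 \<le> \<alpha>"
    using gap[of 0 0 1 1] jensen_gap_half_0[of \<alpha>] powr_half_le_half_iff[of \<alpha>] by simp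
  moreover have "jensen_gap (pow_fun \<alpha>) (1/2) 2 0 \<le> jensen_gap (pow_fun \<alpha>) (1/2) (2 + s) s"
    if "0 < s" for s using gap[of 0 s 2 "2 + s"] that by simp
  ultimately show "\<alpha> = 1 \<or> 2 \<le> \<alpha>"
    using powr_exponent_ge_2_if_gap_increasing[of \<alpha>] by fastforce
next
  assume "\<alpha> = 1 \<or> 2 \<le> \<alpha>"
  then show "\<forall>C \<in> min_max_cones. loewner_convex_comparable (pow_fun \<alpha>) C"
  proof
    assume "\<alpha> = 1"
    then show ?thesis
      using identity_convex_and_concave(1) convex_comparable_if_arbitrary by blast
  next
    assume \<alpha>: "2 \<le> \<alpha>"
    show ?thesis
      unfolding loewner_convex_comparable_def
    proof (intro ballI impI)
      fix C A B and l :: real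
      assume C: "C \<in> min_max_cones" and AB: "A \<in> C" "B \<in> C" "B \<preceq>\<^sub>L A" and l: "l \<in> {0..1}"
      obtain n s where "ranking n s" and Cs: "C = rank_class (\<le>) n s"
        using C by (rule min_max_cones_cases)
      then interpret ranking n s by simp
      obtain g where g: "A = rank_mat n s g" "g 0 = 0"
        using AB(1) Cs rank_class_levelsE by metis
      obtain h where h: "B = rank_mat n s h" "h 0 = 0" "\<forall>k<n. h k \<le> h (Suc k)"
        "\<And>k. k \<le> n \<Longrightarrow> 0 \<le> h k" using AB(2) Cs rank_class_levelsE by metis
      have le: "h k \<le> g k" if "k \<le> n" for k
        using levels_le_if_loewner_le that AB(3) g(1,2) h(1,2) by blast
      have "\<forall>k<n. h (Suc k) - h k \<le> g (Suc k) - g k"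
        using AB(3) g h by (simp add: loewner_le_rank_mat_iff)
      then have "\<forall>k<n. jensen_gap (pow_fun \<alpha>) l (g k) (h k)
          \<le> jensen_gap (pow_fun \<alpha>) l (g (Suc k)) (h (Suc k))"
        using \<alpha> l h le by (auto intro!: jensen_gap_powr_mono)
      then show "loewner_convex_ineq (pow_fun \<alpha>) A B l"
        using g h by (simp add: convex_ineq_rank_mat_iff)
    qed
  qed
qed

lemma concave_comparable_pow_fun_iff:
  assumes "0 < \<alpha>"
  shows "(\<forall>C \<in> min_max_cones. loewner_concave_comparable (pow_fun \<alpha>) C) \<longleftrightarrow> \<alpha> = 1"
proof
  assume "\<forall>C \<in> min_max_cones. loewner_concave_comparable (pow_fun \<alpha>) C"
  then have "loewner_concave_comparable (pow_fun \<alpha>) (min_cone 2)" using min_cone_2_in_cones by blast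
  then have gap: "jensen_gap (pow_fun \<alpha>) (1/2) u u' \<le> 0 \<and>
      jensen_gap (pow_fun \<alpha>) (1/2) v v' \<le> jensen_gap (pow_fun \<alpha>) (1/2) u u'"
    if "0 \<le> u'" "u' \<le> v'" "u' \<le> u" "v' - u' \<le> v - u" for u v u' v'
    using that two_level_mat_in_min_cone[of u v] two_level_mat_in_min_cone[of u' v']
      two_level_concave_ineq_iff[of "pow_fun \<alpha>" u v u' v' "1/2"]
    by (auto simp: loewner_concave_comparable_def two_level_loewner_le_iff)
  have "1/2 \<le> (1/2) powr \<alpha>"
    using gap[of 0 0 1 1] jensen_gap_half_0[of \<alpha>] by simp
  then have "\<alpha> \<le> 1" using powr_less_mono'[of "1/2" 1 \<alpha>] by fastforce
  moreover have "jensen_gap (pow_fun \<alpha>) (1/2) (2 + s) s \<le> jensen_gap (pow_fun \<alpha>) (1/2) 2 0"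
    if "0 < s" for s using gap[of 0 s 2 "2 + s"] that by simp
  ultimately show "\<alpha> = 1"
    using powr_exponent_eq_1_if_gap_decreasing[OF assms] by blast
next
  assume "\<alpha> = 1"
  then show "\<forall>C \<in> min_max_cones. loewner_concave_comparable (pow_fun \<alpha>) C"
    using identity_convex_and_concave(2) concave_comparable_if_arbitrary by blast
qed

text \<open>
  Comparable pairs give \<open>\<alpha> \<ge> 1\<close>. The step from \<open>(1, 0)\<close> to \<open>(1, 1)\<close>, in which only the smaller level
  moves, is not available for comparable pairs; it leads to a vanishing gap and so bounds the gap at
  \<open>(1, 0)\<close> by 0, which means \<open>\<alpha> \<le> 1\<close>.
\<close>

lemma convex_arbitrary_pow_fun_iff:
  assumes "0 < \<alpha>"
  shows "(\<forall>C \<in> min_max_cones. loewner_convex_arbitrary (pow_fun \<alpha>) C) \<longleftrightarrow> \<alpha> = 1"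
proof
  assume convex: "\<forall>C \<in> min_max_cones. loewner_convex_arbitrary (pow_fun \<alpha>) C"
  then have "1 \<le> \<alpha>"
    using convex_comparable_pow_fun_iff[OF assms] convex_comparable_if_arbitrary by fastforce
  have "loewner_convex_ineq (pow_fun \<alpha>) (two_level_mat 1 1) (two_level_mat 0 1) (1/2)"
    using convex min_cone_2_in_cones two_level_mat_in_min_cone
    by (simp add: loewner_convex_arbitrary_def)
  then have "jensen_gap (pow_fun \<alpha>) (1/2) 1 0 \<le> jensen_gap (pow_fun \<alpha>) (1/2) 1 1"
    by (simp add: two_level_convex_ineq_iff)
  then have "1/2 \<le> (1/2) powr \<alpha>"
    unfolding jensen_gap_half_0 by (simp add: jensen_gap_def pow_fun_def)
  then have "\<alpha> \<le> 1" using powr_less_mono'[of "1/2" 1 \<alpha>] by fastforce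
  then show "\<alpha> = 1" using \<open>1 \<le> \<alpha>\<close> by simp
qed (use identity_convex_and_concave(1) in blast)

lemma concave_arbitrary_pow_fun_iff:
  assumes "0 < \<alpha>"
  shows "(\<forall>C \<in> min_max_cones. loewner_concave_arbitrary (pow_fun \<alpha>) C) \<longleftrightarrow> \<alpha> = 1"
  using concave_comparable_pow_fun_iff[OF assms] concave_comparable_if_arbitrary
    identity_convex_and_concave(2) by blast

theorem corollary5p8:
  fixes \<alpha> :: real
  assumes "\<alpha> > 0"
  shows
    "(\<forall>n \<ge> 1. \<forall>A \<in> min_cone n \<union> max_cone n.
        psd_mat (map_mat (pow_fun \<alpha>) A) \<and> totally_nonneg (map_mat (pow_fun \<alpha>) A)) \<and>
     (\<forall>n \<ge> 1.
        preserves_class (pow_fun \<alpha>) (strict_min_class n) \<and>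
        preserves_class (pow_fun \<alpha>) (strict_max_class n) \<and>
        strict_min_class n = inverse_M_min_class n \<and>
        strict_max_class n = inverse_M_max_class n \<and>
        preserves_class (pow_fun \<alpha>) (inverse_M_min_class n) \<and>
        preserves_class (pow_fun \<alpha>) (inverse_M_max_class n)) \<and>
     ((\<forall>C \<in> min_max_cones. preserves_loewner_order (pow_fun \<alpha>) C) \<longleftrightarrow> \<alpha> \<ge> 1) \<and>
     (((\<forall>C \<in> min_max_cones. loewner_convex_arbitrary (pow_fun \<alpha>) C) \<longleftrightarrow>
       (\<forall>C \<in> min_max_cones. loewner_concave_arbitrary (pow_fun \<alpha>) C)) \<and>
      ((\<forall>C \<in> min_max_cones. loewner_convex_arbitrary (pow_fun \<alpha>) C) \<longleftrightarrow> \<alpha> = 1)) \<and>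
     ((\<forall>C \<in> min_max_cones. loewner_convex_comparable (pow_fun \<alpha>) C) \<longleftrightarrow> \<alpha> = 1 \<or> \<alpha> \<ge> 2) \<and>
     ((\<forall>C \<in> min_max_cones. loewner_concave_comparable (pow_fun \<alpha>) C) \<longleftrightarrow> \<alpha> = 1)"
proof (intro conjI allI impI ballI)
  fix n A assume "A \<in> min_cone n \<union> max_cone n"
  then have "A \<in> rank_class (\<le>) n Suc \<or> A \<in> rank_class (\<le>) n (\<lambda>i. n - i)"
    by (simp add: min_cone_eq max_cone_eq)
  then show "psd_mat (map_mat (pow_fun \<alpha>) A)" "totally_nonneg (map_mat (pow_fun \<alpha>) A)"
    using pow_fun_psd_totally_nonneg[OF assms] ranking_Suc ranking_reverse by blast+
qed (simp_all only: strict_min_class_eq strict_max_class_eq inverse_M_min_class_eq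
    inverse_M_max_class_eq pow_fun_preserves_strict_rank_class[OF assms]
    preserves_loewner_order_pow_fun_iff convex_arbitrary_pow_fun_iff[OF assms]
    concave_arbitrary_pow_fun_iff[OF assms] convex_comparable_pow_fun_iff[OF assms]
    concave_comparable_pow_fun_iff[OF assms])

end
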